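(* Let $a,b,c,\mu\in\mathbb{C}$ with $\operatorname{Re}c>0$ and $\operatorname{Re}\mu>0$. Then for all $x\in(-\infty,0)\cup(0,1)$ $$\int_{0<y/x<1}|y|^{c-1}(1-y)^{b-c-\mu}\,{}_2F_1(a,b;c;y)\,\frac{|x-y|^{\mu-1}}{\Gamma(\mu)}\,dy=\frac{\Gamma(c)}{\Gamma(c+\mu)}\,|x|^{c+\mu-1}(1-x)^{b-c}\,{}_2F_1(a+\mu,b;c+\mu;x),$$ where the integral is over the open interval with endpoints $0$ and $x$ (with respect to Lebesgue measure).
   Context: ${}_2F_1(a,b;c;z)$ denotes the Gauss hypergeometric function, defined for $|z|<1$ by $\sum_{k\ge0}\frac{(a)_k(b)_k}{(c)_k\,k!}z^k$ (with $c\notin\mathbb{Z}_{\le0}$) and extended by its one-valued analytic continuation to $\mathbb{C}\setminus[1,\infty)$. *)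

theory Defs
  imports "HOL-Analysis.Analysis"
begin

definition hyp2F1_series :: "complex \<Rightarrow> complex \<Rightarrow> complex \<Rightarrow> complex \<Rightarrow> complex" where
  "hyp2F1_series a b c z =
     (\<Sum>k. pochhammer a k * pochhammer b k / (pochhammer c k * fact k) * z ^ k)"

text \<open>
  The one-valued analytic continuation of the Gauss series to the plane cut along
  \<open>[1,\<infinity>)\<close>. The cut plane is connected, so by the identity theorem the chosen
  function is uniquely determined there; values on the cut itself are unspecified, and parameters
  \<open>c \<in> \<int>\<^sub>\<le>\<^sub>0\<close> are outside the intended domain.
\<close>
definition hyp2F1 :: "complex \<Rightarrow> complex \<Rightarrow> complex \<Rightarrow> complex \<Rightarrow> complex" where
  "hyp2F1 a b c =
     (SOME f. f holomorphic_on (- complex_of_real ` {1..}) \<and>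
              (\<forall>z. norm z < 1 \<longrightarrow> f z = hyp2F1_series a b c z))"

end

theory Submission
  imports Defs "HOL-Complex_Analysis.Conformal_Mappings"
begin

text \<open>
  Substituting \<open>y = t x\<close> turns the integral into
  \<open>H(z) = \<integral>\<^sub>0\<^sup>1 t\<^sup>c\<^sup>-\<^sup>1 (1 - t)\<^sup>\<mu>\<^sup>-\<^sup>1 G(t z) dt\<close> at \<open>z = x\<close>, where
  \<open>G(z) = (1 - z)\<^sup>b\<^sup>-\<^sup>c\<^sup>-\<^sup>\<mu> F(a,b;c;z)\<close>. The cut plane is star-shaped about \<open>0\<close>, so \<open>H\<close> is
  holomorphic on it and it suffices to compare power series at \<open>0\<close>. By the Beta integral, passing
  from \<open>G\<close> to \<open>H\<close> multiplies the \<open>n\<close>-th coefficient by \<open>B(c,\<mu>) (c)\<^sub>n / (c + \<mu>)\<^sub>n\<close>. Pfaff's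
  transformation writes \<open>G\<close> as a combination of the functions \<open>z\<^sup>k (1 - z)\<^sup>-\<^sup>c\<^sup>-\<^sup>\<mu>\<^sup>-\<^sup>k\<close>, which this
  multiplier maps to multiples of \<open>z\<^sup>k (1 - z)\<^sup>-\<^sup>c\<^sup>-\<^sup>k\<close>; a second use of Pfaff's transformation
  identifies the result. The same integral transform applied to \<open>(1 - z)\<^sup>-\<^sup>a\<close> (Euler's integral),
  together with contiguous relations, gives the analytic continuation of the Gauss series.
\<close>

subsection \<open>Coefficients of the Gauss series\<close>

text \<open>These are the Taylor coefficients at 0 of \<open>(1 - z) powr (- s)\<close>, that is,
  the generalised binomial coefficients of \<open>- s\<close> with their signs absorbed.\<close>

definition binom_coeff :: "complex \<Rightarrow> nat \<Rightarrow> complex" where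
  "binom_coeff s n = pochhammer s n / fact n"

definition gauss_coeff :: "complex \<Rightarrow> complex \<Rightarrow> complex \<Rightarrow> nat \<Rightarrow> complex" where
  "gauss_coeff a b c n = pochhammer a n * pochhammer b n / (pochhammer c n * fact n)"

lemma pochhammer_nonzero_if_Re_pos:
  assumes "Re c > 0"
  shows "pochhammer c n \<noteq> 0"
proof
  assume "pochhammer c n = 0"
  then obtain k where "c = - of_nat k"
    by (auto simp: pochhammer_eq_0_iff)
  with assms show False
    by simp
qed

text \<open>Coefficient form of multiplying \<open>(1 - z) powr (- s)\<close> by
  \<open>(1 - z) powr (- t)\<close>; as a finite identity it is the binomial theorem for rising
  factorials.\<close>

lemma binom_coeff_convolution:
  "(\<Sum>k\<le>n. binom_coeff s k * binom_coeff t (n - k)) = binom_coeff (s + t) n"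
proof -
  have "binom_coeff (s + t) n
      = (\<Sum>k\<le>n. of_nat (n choose k) * pochhammer s k * pochhammer t (n - k) / fact n)"
    by (simp add: binom_coeff_def pochhammer_binomial_sum sum_divide_distrib)
  also have "\<dots> = (\<Sum>k\<le>n. binom_coeff s k * binom_coeff t (n - k))"
    by (intro sum.cong) (auto simp: binom_coeff_def binomial_fact field_simps)
  finally show ?thesis ..
qed

text \<open>
  The coefficients in Pfaff's transformation
  \<open>F(a,b;c;z) = (1 - z)\<^sup>-\<^sup>b F(c - a,b;c;z/(z - 1))\<close>, expanded at \<open>0\<close>.
\<close>

lemma gauss_coeff_Pfaff:
  assumes "Re c > 0"
  shows "gauss_coeff a b c n
      = (\<Sum>k\<le>n. (-1) ^ k * gauss_coeff (c - a) b c k * binom_coeff (b + of_nat k) (n - k))"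
proof -
  have c: "\<forall>i\<in>{0..<n}. c \<noteq> - of_nat i"
    using assms by auto
  \<comment> \<open>Merging \<open>(b)_k\<close> with \<open>(b + k)_(n-k)\<close> takes
    \<open>b\<close> out of the sum, and \<open>n! / (n - k)!\<close> is \<open>(-n)_k\<close> up to
    the sign \<open>(-1) ^ k\<close>. What remains is the terminating series
    \<open>F(c - a, -n; c; 1)\<close>, which Chu-Vandermonde evaluates to
    \<open>(a)_n / (c)_n\<close>.\<close>
  have term_eq: "(-1) ^ k * gauss_coeff (c - a) b c k * binom_coeff (b + of_nat k) (n - k)
      = pochhammer b n / fact n
        * (pochhammer (c - a) k * pochhammer (- of_nat n) k / (fact k * pochhammer c k))"
    if "k \<le> n" for k
  proof -
    have "(-1) ^ k * pochhammer (- of_nat n) k / fact k = (of_nat n gchoose k :: complex)"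
      by (simp add: gbinomial_pochhammer)
    also have "\<dots> = fact n / (fact k * fact (n - k))"
      using that by (simp add: binomial_fact flip: binomial_gbinomial)
    finally have "(-1) ^ k * pochhammer (- of_nat n) k = (fact n / fact (n - k) :: complex)"
      by (simp add: field_simps)
    hence "(-1) ^ k * ((-1) ^ k * pochhammer (- of_nat n) k)
        = (-1) ^ k * (fact n / fact (n - k) :: complex)"
      by (rule arg_cong)
    hence neg: "pochhammer (- of_nat n) k = (-1) ^ k * (fact n / fact (n - k) :: complex)"
      by (simp add: mult.assoc [symmetric] flip: power_mult_distrib)
    have "pochhammer b n = pochhammer b k * pochhammer (b + of_nat k) (n - k)"
      using that by (rule pochhammer_product)
    thus ?thesis
      by (simp add: gauss_coeff_def binom_coeff_def neg mult_ac)
  qed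
  have "(\<Sum>k\<le>n. (-1) ^ k * gauss_coeff (c - a) b c k * binom_coeff (b + of_nat k) (n - k))
      = pochhammer b n / fact n
        * (\<Sum>k\<le>n. pochhammer (c - a) k * pochhammer (- of_nat n) k / (fact k * pochhammer c k))"
    unfolding sum_distrib_left by (intro sum.cong refl term_eq) simp
  also have "(\<Sum>k\<le>n. pochhammer (c - a) k * pochhammer (- of_nat n) k / (fact k * pochhammer c k))
      = pochhammer (c - (c - a)) n / pochhammer c n"
    using Vandermonde_pochhammer[OF c, of "c - a"] by (simp add: atMost_atLeast0)
  finally show ?thesis
    by (simp add: gauss_coeff_def field_simps)
qed

text \<open>Multiplying Pfaff's expansion by \<open>(1 - z) powr (- s)\<close> only adds
  \<open>s\<close> to the exponent in each summand. On coefficients: exchange the triangular double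
  sum, then convolve the two binomial factors for each fixed \<open>k\<close>.\<close>

lemma binom_gauss_convolution:
  assumes "Re c > 0"
  shows "(\<Sum>j\<le>n. binom_coeff s j * gauss_coeff a b c (n - j))
      = (\<Sum>k\<le>n. (-1) ^ k * gauss_coeff (c - a) b c k * binom_coeff (s + b + of_nat k) (n - k))"
proof -
  let ?g = "\<lambda>j k. binom_coeff s j
    * ((-1) ^ k * gauss_coeff (c - a) b c k * binom_coeff (b + of_nat k) (n - j - k))"
  have "(\<Sum>j\<le>n. binom_coeff s j * gauss_coeff a b c (n - j))
      = (\<Sum>j\<le>n. sum (?g j) {k. k \<in> {..n} \<and> j + k \<le> n})"
  proof (intro sum.cong refl)
    fix j assume "j \<in> {..n}"
    hence "{k. k \<in> {..n} \<and> j + k \<le> n} = {..n - j}"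
      by auto
    thus "binom_coeff s j * gauss_coeff a b c (n - j)
        = sum (?g j) {k. k \<in> {..n} \<and> j + k \<le> n}"
      using gauss_coeff_Pfaff[OF assms, of a b "n - j"] by (simp add: sum_distrib_left)
  qed
  also have "\<dots> = (\<Sum>k\<le>n. \<Sum>j\<in>{j. j \<in> {..n} \<and> j + k \<le> n}. ?g j k)"
    by (rule sum.swap_restrict) auto
  also have "\<dots> = (\<Sum>k\<le>n. (-1) ^ k * gauss_coeff (c - a) b c k
                        * binom_coeff (s + b + of_nat k) (n - k))"
  proof (intro sum.cong refl)
    fix k assume "k \<in> {..n}"
    hence "{j. j \<in> {..n} \<and> j + k \<le> n} = {..n - k}"
      by auto
    moreover have "binom_coeff (s + b + of_nat k) (n - k)
        = (\<Sum>j\<le>n - k. binom_coeff s j * binom_coeff (b + of_nat k) (n - k - j))"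
      using binom_coeff_convolution[of s "b + of_nat k" "n - k"] by (simp only: add.assoc)
    ultimately show "(\<Sum>j\<in>{j. j \<in> {..n} \<and> j + k \<le> n}. ?g j k)
        = (-1) ^ k * gauss_coeff (c - a) b c k * binom_coeff (s + b + of_nat k) (n - k)"
      by (simp add: sum_distrib_left mult_ac add.commute)
  qed
  finally show ?thesis .
qed

text \<open>The choices \<open>s = c + \<mu> - b\<close> and \<open>s = c - b\<close> cancel
  \<open>b\<close> from the binomial factors, leaving \<open>c + \<mu> + k\<close> and
  \<open>c + k\<close>. Since \<open>(c + \<mu>) - (a + \<mu>) = c - a\<close>, both Pfaff
  expansions have the same numerators, and splitting \<open>(c)_n\<close> and
  \<open>(c + \<mu>)_n\<close> at \<open>k\<close> shows that the multiplier carries one sum to the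
  other term by term.\<close>

lemma pochhammer_quotient_convolution:
  assumes "Re c > 0" "Re \<mu> > 0"
  shows "pochhammer c n / pochhammer (c + \<mu>) n
        * (\<Sum>j\<le>n. binom_coeff (c + \<mu> - b) j * gauss_coeff a b c (n - j))
      = (\<Sum>j\<le>n. binom_coeff (c - b) j * gauss_coeff (a + \<mu>) b (c + \<mu>) (n - j))"
proof -
  have cm: "Re (c + \<mu>) > 0"
    using assms by simp
  have "pochhammer c n / pochhammer (c + \<mu>) n
          * ((-1) ^ k * gauss_coeff (c - a) b c k * binom_coeff (c + \<mu> + of_nat k) (n - k))
      = (-1) ^ k * gauss_coeff (c - a) b (c + \<mu>) k * binom_coeff (c + of_nat k) (n - k)"
    if "k \<le> n" for k
  proof -
    have "pochhammer (c + \<mu>) n = pochhammer (c + \<mu>) k * pochhammer (c + \<mu> + of_nat k) (n - k)"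
      and "pochhammer c n = pochhammer c k * pochhammer (c + of_nat k) (n - k)"
      using that by (auto intro: pochhammer_product)
    moreover have "pochhammer (c + \<mu> + of_nat k) (n - k) \<noteq> 0"
      using cm by (intro pochhammer_nonzero_if_Re_pos) simp
    ultimately show ?thesis
      using pochhammer_nonzero_if_Re_pos[OF assms(1), of k] pochhammer_nonzero_if_Re_pos[OF cm, of k]
      by (simp add: gauss_coeff_def binom_coeff_def field_simps)
  qed
  thus ?thesis
    by (simp add: binom_gauss_convolution[OF assms(1)] binom_gauss_convolution[OF cm] sum_distrib_left)
qed

section \<open>Convergence of the Gauss and binomial series and of their product\<close>

text \<open>When \<open>c + of_nat n\<close> is 0, both sides are 0 by the convention for division
  by zero, so the recursion holds for every \<open>c\<close>.\<close>

lemma gauss_coeff_Suc: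
  "gauss_coeff a b c (Suc n)
     = gauss_coeff a b c n * ((a + of_nat n) * (b + of_nat n) / ((c + of_nat n) * (1 + of_nat n)))"
  by (simp add: gauss_coeff_def pochhammer_Suc add.commute mult_ac)

lemma summable_norm_gauss_series:
  assumes "norm z < 1"
  shows "summable (\<lambda>n. norm (gauss_coeff a b c n * z ^ n))"
proof -
  obtain r where r: "norm z < r" "r < 1"
    using assms dense by blast
  \<comment> \<open>The ratio of consecutive terms in norm. Dividing each of the four linear factors
    by \<open>n\<close> shows that it tends to \<open>norm z\<close>, hence is eventually below
    \<open>r\<close>.\<close>
  let ?q = "\<lambda>n. norm ((a + of_nat n) * (b + of_nat n) / ((c + of_nat n) * (1 + of_nat n)) * z)"
  have lin: "(\<lambda>n. (u + of_nat n) / of_nat n) \<longlonglongrightarrow> 1" for u :: complex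
  proof -
    have "(\<lambda>n. u / of_nat n + 1) \<longlonglongrightarrow> 0 + 1"
      by (intro tendsto_intros lim_const_over_n)
    moreover have "eventually (\<lambda>n. u / of_nat n + 1 = (u + of_nat n) / of_nat n) sequentially"
      using eventually_gt_at_top[of 0] by eventually_elim (simp add: field_simps)
    ultimately show ?thesis
      using Lim_transform_eventually by fastforce
  qed
  have "(\<lambda>n. norm (((a + of_nat n) / of_nat n) * ((b + of_nat n) / of_nat n)
            / (((c + of_nat n) / of_nat n) * ((1 + of_nat n) / of_nat n)) * z))
          \<longlonglongrightarrow> norm (1 * 1 / (1 * 1) * z)"
    by (intro tendsto_intros lin) simp_all
  moreover have "eventually (\<lambda>n. norm (((a + of_nat n) / of_nat n) * ((b + of_nat n) / of_nat n)
            / (((c + of_nat n) / of_nat n) * ((1 + of_nat n) / of_nat n)) * z) = ?q n) sequentially"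
    using eventually_gt_at_top[of 0] by eventually_elim simp
  ultimately have "?q \<longlonglongrightarrow> norm z"
    using Lim_transform_eventually by fastforce
  from order_tendstoD(2)[OF this r(1)]
  obtain N where N: "\<And>n. n \<ge> N \<Longrightarrow> ?q n < r"
    by (auto simp: eventually_sequentially)
  show ?thesis
  proof (rule summable_ratio_test[OF r(2)])
    fix n assume "n \<ge> N"
    have "norm (gauss_coeff a b c (Suc n) * z ^ Suc n) = ?q n * norm (gauss_coeff a b c n * z ^ n)"
      by (simp add: gauss_coeff_Suc norm_mult norm_divide)
    also have "\<dots> \<le> r * norm (gauss_coeff a b c n * z ^ n)"
      using N[OF \<open>n \<ge> N\<close>] by (intro mult_right_mono) auto
    finally show "norm (norm (gauss_coeff a b c (Suc n) * z ^ Suc n))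
        \<le> r * norm (norm (gauss_coeff a b c n * z ^ n))"
      by simp
  qed
qed

lemma hyp2F1_series_sums:
  assumes "norm z < 1"
  shows "(\<lambda>n. gauss_coeff a b c n * z ^ n) sums hyp2F1_series a b c z"
  using summable_norm_cancel[OF summable_norm_gauss_series[OF assms]]
  by (simp add: hyp2F1_series_def gauss_coeff_def sums_iff)

lemma binom_series_sums:
  assumes "norm z < 1"
  shows "(\<lambda>n. binom_coeff s n * z ^ n) sums ((1 - z) powr (- s))"
proof -
  have "(\<lambda>n. (- s gchoose n) * (- z) ^ n) sums ((1 + - z) powr (- s))"
    using assms by (intro gen_binomial_complex) simp
  moreover have "(- s gchoose n) * (- z) ^ n = binom_coeff s n * z ^ n" for n
    using power_mult_distrib[of "-1" "- z" n] by (simp add: gbinomial_pochhammer binom_coeff_def)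
  ultimately show ?thesis
    by simp
qed

lemma summable_norm_binom_series:
  assumes "norm z < 1"
  shows "summable (\<lambda>n. norm (binom_coeff s n * z ^ n))"
  \<comment> \<open>The binomial series is the Gauss series with parameters \<open>s, 1; 1\<close>,
    because \<open>(1)_n = n!\<close>.\<close>
  using summable_norm_gauss_series[OF assms, of s 1 1]
  by (simp add: gauss_coeff_def binom_coeff_def flip: pochhammer_fact)

lemma binom_gauss_series_sums:
  assumes "norm z < 1"
  shows "(\<lambda>n. (\<Sum>j\<le>n. binom_coeff s j * gauss_coeff a b c (n - j)) * z ^ n)
           sums ((1 - z) powr (- s) * hyp2F1_series a b c z)"
proof -
  have "(\<lambda>n. \<Sum>j\<le>n. (binom_coeff s j * z ^ j) * (gauss_coeff a b c (n - j) * z ^ (n - j)))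
      sums ((\<Sum>n. binom_coeff s n * z ^ n) * (\<Sum>n. gauss_coeff a b c n * z ^ n))"
    by (intro Cauchy_product_sums summable_norm_binom_series summable_norm_gauss_series assms)
  moreover have "(\<Sum>j\<le>n. (binom_coeff s j * z ^ j) * (gauss_coeff a b c (n - j) * z ^ (n - j)))
      = (\<Sum>j\<le>n. binom_coeff s j * gauss_coeff a b c (n - j)) * z ^ n" for n
    unfolding sum_distrib_right
  proof (intro sum.cong refl)
    fix j assume "j \<in> {..n}"
    hence "z ^ n = z ^ j * z ^ (n - j)"
      by (simp flip: power_add)
    thus "(binom_coeff s j * z ^ j) * (gauss_coeff a b c (n - j) * z ^ (n - j))
        = binom_coeff s j * gauss_coeff a b c (n - j) * z ^ n"
      by (simp add: mult_ac)
  qed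
  ultimately show ?thesis
    using binom_series_sums[OF assms] hyp2F1_series_sums[OF assms] by (simp add: sums_iff)
qed

subsection \<open>The complex Beta integral\<close>

lemma not_nonpos_Int_if_Re_pos:
  assumes "Re z > 0"
  shows "z \<notin> \<int>\<^sub>\<le>\<^sub>0"
  using assms by (auto elim!: nonpos_Ints_cases')

text \<open>In norm the integrand is the real Beta integrand with parameters \<open>Re p\<close> and
  \<open>Re q\<close>.\<close>

lemma set_integrable_complex_Beta:
  assumes "Re p > 0" "Re q > 0"
  shows "set_integrable lborel {0<..<1}
           (\<lambda>t. of_real t powr (p - 1) * of_real (1 - t) powr (q - 1) :: complex)"
proof -
  have "set_integrable lborel {0<..<1} (\<lambda>t. t powr (Re p - 1) * (1 - t) powr (Re q - 1))"
    by (rule set_integrable_subset[OF integrable_Beta[OF assms]]) auto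
  hence "integrable lborel
      (\<lambda>t. indicator {0<..<1} t *\<^sub>R (t powr (Re p - 1) * (1 - t) powr (Re q - 1)))"
    by (simp add: set_integrable_def)
  thus ?thesis
    unfolding set_integrable_def
  proof (rule Bochner_Integration.integrable_bound)
    show "AE t in lborel.
        norm (indicator {0<..<1} t *\<^sub>R (of_real t powr (p - 1) * of_real (1 - t) powr (q - 1) :: complex))
        \<le> norm (indicator {0<..<1} t *\<^sub>R (t powr (Re p - 1) * (1 - t) powr (Re q - 1)))"
      by (intro AE_I2) (auto simp: indicator_def norm_mult norm_powr_real_powr simp flip: of_real_diff)
  qed measurable
qed

section \<open>The Beta integral from a convolution of Gamma integrands\<close>

text \<open>Euler's integrand for the Gamma function, extended by 0 to the whole line so that
  convolutions and translations need no limits of integration.\<close>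

definition Gamma_kernel :: "complex \<Rightarrow> real \<Rightarrow> complex" where
  "Gamma_kernel z t = indicator {0<..} t *\<^sub>R (of_real t powr (z - 1) / of_real (exp t))"

lemma Gamma_kernel_nonpos: "t \<le> 0 \<Longrightarrow> Gamma_kernel z t = 0"
  by (simp add: Gamma_kernel_def)

lemma Gamma_kernel_measurable [measurable]: "Gamma_kernel z \<in> borel_measurable borel"
  unfolding Gamma_kernel_def by measurable

lemma Gamma_kernel_integral:
  assumes "Re z > 0"
  shows "integrable lborel (Gamma_kernel z)" and "integral\<^sup>L lborel (Gamma_kernel z) = Gamma z"
proof -
  have "integrable lebesgue (Gamma_kernel z)"
    using absolutely_integrable_Gamma_integral'[OF assms]
    by (simp add: Gamma_kernel_def[abs_def] set_integrable_def)
  thus int: "integrable lborel (Gamma_kernel z)"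
    by (subst (asm) integrable_completion) auto
  hence "set_integrable lborel {0<..} (\<lambda>t. of_real t powr (z - 1) / of_real (exp t) :: complex)"
    by (simp add: Gamma_kernel_def[abs_def] set_integrable_def)
  from set_borel_integral_eq_integral(2)[OF this] Gamma_integral_complex'[OF assms]
  show "integral\<^sup>L lborel (Gamma_kernel z) = Gamma z"
    by (simp add: Gamma_kernel_def[abs_def] set_lebesgue_integral_def integral_unique)
qed

text \<open>Under \<open>t = u * s\<close> the powers of \<open>u\<close> factor out and the
  exponentials combine to \<open>exp u\<close>, so only a Beta integrand in \<open>s\<close>
  remains. For \<open>u \<le> 0\<close> both sides vanish.\<close>

lemma Gamma_kernel_convolution:
  "(\<integral>t. Gamma_kernel p t * Gamma_kernel q (u - t) \<partial>lborel)
     = (LINT s:{0<..<1}|lborel. of_real s powr (p - 1) * of_real (1 - s) powr (q - 1))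
       * Gamma_kernel (p + q) u"
proof (cases "u > 0")
  case True
  have dilate: "Gamma_kernel p (u * s) * Gamma_kernel q (u - u * s)
      = of_real u powr (p + q - 2) / of_real (exp u)
        * (indicator {0<..<1} s *\<^sub>R (of_real s powr (p - 1) * of_real (1 - s) powr (q - 1)))" for s
  proof (cases "s \<in> {0<..<1}")
    case s: True
    have "Gamma_kernel p (u * s) * Gamma_kernel q (u - u * s)
        = (of_real u * of_real s) powr (p - 1) * (of_real u * of_real (1 - s)) powr (q - 1)
          / (of_real (exp (u * s) * exp (u - u * s)))"
      using True s by (simp add: Gamma_kernel_def right_diff_distrib)
    also have "exp (u * s) * exp (u - u * s) = exp u"
      by (simp flip: exp_add)
    also have "(of_real u * of_real s :: complex) powr (p - 1)
        = of_real u powr (p - 1) * of_real s powr (p - 1)"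
      using True s by (intro powr_times_real) auto
    also have "(of_real u * of_real (1 - s) :: complex) powr (q - 1)
        = of_real u powr (q - 1) * of_real (1 - s) powr (q - 1)"
      using True s by (intro powr_times_real) auto
    also have "p + q - 2 = (p - 1) + (q - 1)"
      by simp
    ultimately show ?thesis
      using s by (simp only: powr_add) simp
  next
    case False
    \<comment> \<open>Since \<open>u > 0\<close>, one of the two kernels is then evaluated at a
      nonpositive point.\<close>
    hence "s \<le> 0 \<or> 1 \<le> s"
      by auto
    hence "u * s \<le> u * 0 \<or> u * 1 \<le> u * s"
      using True mult_left_mono[of s 0 u] mult_left_mono[of 1 s u] by argo
    hence "u * s \<le> 0 \<or> u - u * s \<le> 0"
      by simp
    hence "Gamma_kernel p (u * s) * Gamma_kernel q (u - u * s) = 0"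
      by (metis Gamma_kernel_nonpos mult_zero_left mult_zero_right)
    thus ?thesis
      using False by simp
  qed
  have "(\<integral>t. Gamma_kernel p t * Gamma_kernel q (u - t) \<partial>lborel)
      = u *\<^sub>R (\<integral>s. Gamma_kernel p (u * s) * Gamma_kernel q (u - u * s) \<partial>lborel)"
    using True lborel_integral_real_affine[of u "\<lambda>t. Gamma_kernel p t * Gamma_kernel q (u - t)" 0] by simp
  also have "\<dots> = u *\<^sub>R (of_real u powr (p + q - 2) / of_real (exp u)
        * (LINT s:{0<..<1}|lborel. of_real s powr (p - 1) * of_real (1 - s) powr (q - 1)))"
    unfolding dilate integral_mult_right_zero set_lebesgue_integral_def ..
  finally have "(\<integral>t. Gamma_kernel p t * Gamma_kernel q (u - t) \<partial>lborel) = \<dots>" .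
  \<comment> \<open>The Jacobian \<open>u\<close> of the substitution supplies the power missing
    from the exponent of \<open>Gamma_kernel (p + q)\<close>.\<close>
  moreover have "of_real u * of_real u powr (p + q - 2) = (of_real u powr (p + q - 1) :: complex)"
    using True powr_add[of "of_real u" 1 "p + q - 2"] by simp
  ultimately show ?thesis
    using True by (simp add: Gamma_kernel_def scaleR_conv_of_real mult_ac)
next
  case False
  hence zero: "Gamma_kernel p t * Gamma_kernel q (u - t) = 0" for t
    by (cases "t \<le> 0") (simp_all add: Gamma_kernel_nonpos)
  show ?thesis
    unfolding zero using False by (simp add: Gamma_kernel_nonpos)
qed

text \<open>Integrate the convolution over \<open>u\<close>: directly this gives the integral times
  \<open>Gamma (p + q)\<close>, and after exchanging the order it gives
  \<open>Gamma p * Gamma q\<close>.\<close>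

lemma complex_Beta_integral:
  assumes "Re p > 0" "Re q > 0"
  shows "(LINT t:{0<..<1}|lborel. of_real t powr (p - 1) * of_real (1 - t) powr (q - 1)) = Beta p q"
    (is "?B = _")
proof -
  \<comment> \<open>By translation invariance the inner integrals do not depend on \<open>t\<close>;
    this reduces Fubini's integrability condition to that of \<open>Gamma_kernel p\<close>.\<close>
  have shift: "integrable lborel (\<lambda>u. Gamma_kernel q (u - t))"
    "(\<integral>u. Gamma_kernel q (u - t) \<partial>lborel) = Gamma q"
    "(\<integral>u. norm (Gamma_kernel q (u - t)) \<partial>lborel) = (\<integral>u. norm (Gamma_kernel q u) \<partial>lborel)" for t
    using lborel_integrable_real_affine[OF Gamma_kernel_integral(1)[OF assms(2)], of 1 "- t"]
      lborel_integral_real_affine[of 1 "Gamma_kernel q" "- t"]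
      lborel_integral_real_affine[of 1 "\<lambda>u. norm (Gamma_kernel q u)" "- t"]
      Gamma_kernel_integral(2)[OF assms(2)]
    by (simp_all add: add.commute)
  have "integrable (lborel \<Otimes>\<^sub>M lborel) (\<lambda>(t, u). Gamma_kernel p t * Gamma_kernel q (u - t))"
  proof (rule lborel_pair.Fubini_integrable)
    show "(\<lambda>(t, u). Gamma_kernel p t * Gamma_kernel q (u - t)) \<in> borel_measurable (lborel \<Otimes>\<^sub>M lborel)"
      by measurable
    show "integrable lborel
        (\<lambda>t. \<integral>u. norm (case (t, u) of (t, u) \<Rightarrow> Gamma_kernel p t * Gamma_kernel q (u - t)) \<partial>lborel)"
      using Gamma_kernel_integral(1)[OF assms(1)] by (simp add: norm_mult shift)
    show "AE t in lborel.
        integrable lborel (\<lambda>u. case (t, u) of (t, u) \<Rightarrow> Gamma_kernel p t * Gamma_kernel q (u - t))"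
      by (simp add: shift)
  qed
  from lborel_pair.Fubini_integral[OF this]
  have "?B * Gamma (p + q) = Gamma p * Gamma q"
    using assms by (simp add: Gamma_kernel_convolution shift Gamma_kernel_integral)
  moreover have "Gamma (p + q) \<noteq> 0"
    using assms not_nonpos_Int_if_Re_pos[of "p + q"] by (simp add: Gamma_eq_zero_iff)
  ultimately show ?thesis
    by (simp add: Beta_def field_simps)
qed

text \<open>Up to the constant \<open>Beta p q\<close>, this is the factor by which the integral
  transform multiplies the \<open>n\<close>-th Taylor coefficient.\<close>

lemma Beta_add_of_nat:
  fixes p q :: complex
  assumes "Re p > 0" "Re q > 0"
  shows "Beta (p + of_nat n) q = Beta p q * (pochhammer p n / pochhammer (p + q) n)"
proof -
  have "p \<notin> \<int>\<^sub>\<le>\<^sub>0" "p + q \<notin> \<int>\<^sub>\<le>\<^sub>0"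
    using assms by (auto intro!: not_nonpos_Int_if_Re_pos)
  thus ?thesis
    using pochhammer_nonzero_if_Re_pos[of "p + q" n] assms
    by (simp add: Beta_def pochhammer_Gamma Gamma_eq_zero_iff add_ac)
qed

subsection \<open>Dilation integrals on the cut plane\<close>

definition cut_plane :: "complex set" where
  "cut_plane = - complex_of_real ` {1..}"

lemma cut_plane_iff: "z \<in> cut_plane \<longleftrightarrow> \<not> (Im z = 0 \<and> Re z \<ge> 1)"
proof -
  have "z \<in> of_real ` {1..} \<longleftrightarrow> Im z = 0 \<and> Re z \<ge> 1"
    by (auto simp: complex_eq_iff intro!: image_eqI[of _ _ "Re z"])
  thus ?thesis
    by (simp add: cut_plane_def)
qed

lemma open_cut_plane: "open cut_plane"
proof -
  have "closed ({z. Im z = 0} \<inter> {z. Re z \<ge> 1})"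
    by (intro closed_Int closed_Collect_eq closed_Collect_le continuous_intros)
  moreover have "cut_plane = - ({z. Im z = 0} \<inter> {z. Re z \<ge> 1})"
    by (auto simp: cut_plane_iff)
  ultimately show ?thesis
    by (metis open_Compl)
qed

text \<open>Star-shapedness about 0: if \<open>t * z\<close> were on the cut, then
  \<open>t \<noteq> 0\<close> would make \<open>z\<close> real, with
  \<open>Re z \<ge> t * Re z \<ge> 1\<close>.\<close>

lemma of_real_mult_in_cut_plane:
  assumes "z \<in> cut_plane" "t \<in> {0..1}"
  shows "of_real t * z \<in> cut_plane"
proof (rule ccontr)
  assume "of_real t * z \<notin> cut_plane"
  hence t: "t * Im z = 0" "t * Re z \<ge> 1"
    by (auto simp: cut_plane_iff)
  hence "t \<noteq> 0"
    by auto
  moreover have "t * Re z \<le> Re z" if "Re z \<ge> 0"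
    using that assms(2) by (auto intro: mult_left_le_one_le)
  moreover have "Re z \<ge> 0"
    using t(2) assms(2) mult_nonneg_nonpos[of t "Re z"] by fastforce
  ultimately show False
    using assms(1) t by (auto simp: cut_plane_iff)
qed

lemma norm_less_1_in_cut_plane: "norm z < 1 \<Longrightarrow> z \<in> cut_plane"
  using complex_Re_le_cmod[of z] by (auto simp: cut_plane_iff)

lemma connected_cut_plane: "connected cut_plane"
proof (rule starlike_imp_connected)
  have "closed_segment 0 z \<subseteq> cut_plane" if "z \<in> cut_plane" for z
    using of_real_mult_in_cut_plane[OF that]
    by (auto simp: closed_segment_def scaleR_conv_of_real)
  thus "starlike cut_plane"
    unfolding starlike_def by (intro bexI[of _ 0]) (auto simp: cut_plane_iff)
qed

text \<open>On the cut plane \<open>1 - z\<close> avoids the nonpositive reals, the branch cut of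
  \<open>powr\<close>.\<close>

lemma holomorphic_one_minus_powr: "(\<lambda>z. (1 - z) powr s) holomorphic_on cut_plane"
  by (intro holomorphic_intros) (auto simp: cut_plane_iff complex_nonpos_Reals_iff)

lemma cut_plane_identity_theorem:
  assumes "f holomorphic_on cut_plane" "g holomorphic_on cut_plane"
    and "\<And>z. norm z < 1 \<Longrightarrow> f z = g z" and "z \<in> cut_plane"
  shows "f z = g z"
  by (rule analytic_continuation_open[of "ball 0 1" cut_plane f g])
     (use assms in \<open>auto intro: open_cut_plane connected_cut_plane norm_less_1_in_cut_plane\<close>)

section \<open>Holomorphy and Taylor coefficients of dilation integrals\<close>

text \<open>The segment from 0 to \<open>z\<close> is compact, so \<open>G\<close> is bounded on it
  and \<open>\<phi>\<close> dominates up to a constant.\<close>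

lemma integrable_kernel_mult_dilation:
  fixes \<phi> :: "real \<Rightarrow> complex" and G :: "complex \<Rightarrow> complex"
  assumes \<phi>: "set_integrable lborel {0<..<1} \<phi>"
    and G: "continuous_on S G" and z: "\<And>t. t \<in> {0..1} \<Longrightarrow> of_real t * z \<in> S"
  shows "integrable lborel (\<lambda>t. indicator {0<..<1} t *\<^sub>R (\<phi> t * G (of_real t * z)))"
proof -
  have cont: "continuous_on {0..1} (\<lambda>t. G (of_real t * z))"
    by (rule continuous_on_compose2[OF G]) (auto intro!: continuous_intros z)
  have "bounded ((\<lambda>t. G (of_real t * z)) ` {0..1})"
    by (intro compact_imp_bounded compact_continuous_image cont) simp
  then obtain M where M: "\<And>t. t \<in> {0..1} \<Longrightarrow> norm (G (of_real t * z)) \<le> M"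
    unfolding bounded_iff by blast
  have [measurable]: "(\<lambda>t. indicator {0<..<1} t *\<^sub>R \<phi> t) \<in> borel_measurable lborel"
    using \<phi> by (auto simp: set_integrable_def)
  have "(\<lambda>t. indicator {0<..<1} t *\<^sub>R G (of_real t * z)) \<in> borel_measurable borel"
    by (intro borel_measurable_continuous_on_indicator continuous_on_subset[OF cont]) auto
  hence [measurable]: "(\<lambda>t. indicator {0<..<1} t *\<^sub>R G (of_real t * z)) \<in> borel_measurable lborel"
    by simp
  have eq: "indicator {0<..<1} t *\<^sub>R (\<phi> t * G (of_real t * z))
      = (indicator {0<..<1} t *\<^sub>R \<phi> t) * (indicator {0<..<1} t *\<^sub>R G (of_real t * z))" for t
    by (auto simp: indicator_def)
  show ?thesis
  proof (rule Bochner_Integration.integrable_bound)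
    show "integrable lborel (\<lambda>t. M *\<^sub>R (indicator {0<..<1} t *\<^sub>R \<phi> t))"
      using \<phi> unfolding set_integrable_def by (rule integrable_scaleR_right)
    show "(\<lambda>t. indicator {0<..<1} t *\<^sub>R (\<phi> t * G (of_real t * z))) \<in> borel_measurable lborel"
      unfolding eq by measurable
    show "AE t in lborel. norm (indicator {0<..<1} t *\<^sub>R (\<phi> t * G (of_real t * z)))
        \<le> norm (M *\<^sub>R (indicator {0<..<1} t *\<^sub>R \<phi> t))"
    proof (rule AE_I2)
      fix t :: real
      have "norm (\<phi> t) * norm (G (of_real t * z)) \<le> norm (\<phi> t) * \<bar>M\<bar>" if "t \<in> {0<..<1}"
        using M[of t] that by (intro mult_left_mono) auto
      thus "norm (indicator {0<..<1} t *\<^sub>R (\<phi> t * G (of_real t * z)))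
          \<le> norm (M *\<^sub>R (indicator {0<..<1} t *\<^sub>R \<phi> t))"
        by (auto simp: indicator_def norm_mult mult.commute)
    qed
  qed
qed

text \<open>Differentiation under the integral sign: near \<open>z\<close> the difference quotients
  of the integrand are dominated by a constant multiple of \<open>norm (\<phi> t)\<close>.\<close>

lemma holomorphic_kernel_dilation_integral:
  fixes \<phi> :: "real \<Rightarrow> complex" and G :: "complex \<Rightarrow> complex"
  assumes \<phi>: "set_integrable lborel {0<..<1} \<phi>" and S: "open S"
    and star: "\<And>z t. z \<in> S \<Longrightarrow> t \<in> {0..1} \<Longrightarrow> of_real t * z \<in> S"
    and G: "G holomorphic_on S"
  shows "(\<lambda>z. LINT t:{0<..<1}|lborel. \<phi> t * G (of_real t * z)) holomorphic_on S"
proof -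
  let ?f = "\<lambda>z t. indicator {0<..<1} t *\<^sub>R (\<phi> t * G (of_real t * z))"
  let ?f' = "\<lambda>z t. of_real t * (indicator {0<..<1} t *\<^sub>R (\<phi> t * deriv G (of_real t * z)))"
  have G': "continuous_on S (deriv G)"
    using G S by (intro holomorphic_on_imp_continuous_on holomorphic_deriv)
  have int: "integrable lborel (?f z)" if "z \<in> S" for z
    using that by (intro integrable_kernel_mult_dilation[OF \<phi> holomorphic_on_imp_continuous_on[OF G]] star)
  have deriv: "((\<lambda>z. integral\<^sup>L lborel (?f z)) has_field_derivative integral\<^sup>L lborel (?f' z)) (at z)"
    if z: "z \<in> S" for z
  proof -
    obtain r where r: "r > 0" "cball z r \<subseteq> S"
      using S z open_contains_cball by blast
    \<comment> \<open>All dilates of a closed ball around \<open>z\<close> form a compact subset of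
      \<open>S\<close>; a bound \<open>M\<close> for \<open>deriv G\<close> there is uniform in
      \<open>t\<close>.\<close>
    let ?K = "(\<lambda>(t, w). of_real t * w) ` ({0..1::real} \<times> cball z r)"
    have K: "compact ?K"
      by (intro compact_continuous_image compact_Times)
         (auto simp: case_prod_unfold intro!: continuous_intros)
    have "?K \<subseteq> S"
      using r(2) by (auto intro!: star)
    from compact_continuous_image[OF continuous_on_subset[OF G' this] K]
    have "bounded (deriv G ` ?K)"
      by (rule compact_imp_bounded)
    then obtain M where M: "\<And>t w. t \<in> {0..1::real} \<Longrightarrow> w \<in> cball z r \<Longrightarrow> norm (deriv G (of_real t * w)) \<le> M"
      by (fastforce simp: bounded_iff)
    have dG: "((\<lambda>w. G (of_real t * w)) has_field_derivative of_real t * deriv G (of_real t * w)) (at w within A)"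
      if "t \<in> {0..1}" "w \<in> cball z r" for t :: real and w A
    proof -
      have "(G has_field_derivative deriv G (of_real t * w)) (at (of_real t * w))"
        using that r(2) by (intro holomorphic_derivI[OF G S] star) auto
      moreover have "((\<lambda>w. of_real t * w) has_field_derivative of_real t) (at w within A)"
        by (auto intro!: derivative_eq_intros)
      ultimately have "((\<lambda>w. G (of_real t * w)) has_field_derivative deriv G (of_real t * w) * of_real t)
          (at w within A)"
        by (rule DERIV_chain2)
      thus ?thesis
        by (simp add: mult.commute)
    qed
    \<comment> \<open>The mean value inequality on the convex ball turns \<open>M\<close> into a
      Lipschitz constant, using \<open>t \<le> 1\<close> for the inner derivative.\<close>
    have lip: "norm (G (of_real t * w) - G (of_real t * z)) \<le> M * norm (w - z)"
      if t: "t \<in> {0..1}" and w: "w \<in> cball z r" for t :: real and w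
    proof (rule field_differentiable_bound[of "cball z r" "\<lambda>w. G (of_real t * w)"])
      fix u assume u: "u \<in> cball z r"
      show "((\<lambda>w. G (of_real t * w)) has_field_derivative of_real t * deriv G (of_real t * u))
              (at u within cball z r)"
        using t u by (rule dG)
      have "norm (of_real t * deriv G (of_real t * u)) \<le> 1 * M"
        unfolding norm_mult using t M[OF t u] by (intro mult_mono) auto
      thus "norm (of_real t * deriv G (of_real t * u)) \<le> M"
        by simp
    qed (use w r in auto)
    have "((\<lambda>w. (integral\<^sup>L lborel (?f w) - integral\<^sup>L lborel (?f z)) / (w - z))
             \<longlongrightarrow> integral\<^sup>L lborel (?f' z)) (at z within ball z r)"
      \<comment> \<open>Dominated convergence is a statement about sequences, so the limit is tested
        along an arbitrary sequence tending to \<open>z\<close>.\<close>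
      unfolding tendsto_at_iff_sequentially
    proof (intro allI impI)
      fix X assume X: "\<forall>i. X i \<in> ball z r - {z}" "X \<longlonglongrightarrow> z"
      have XS: "X i \<in> S" "X i \<in> cball z r" "X i \<noteq> z" for i
        using X(1)[rule_format, of i] r(2) by auto
      let ?s = "\<lambda>i t. (?f (X i) t - ?f z t) / (X i - z)"
      have "(\<lambda>i. integral\<^sup>L lborel (?s i)) \<longlonglongrightarrow> integral\<^sup>L lborel (?f' z)"
      proof (rule integral_dominated_convergence)
        have [measurable]: "(\<lambda>t. indicator {0<..<1} t *\<^sub>R (\<phi> t * deriv G (of_real t * z)))
            \<in> borel_measurable lborel"
          using integrable_kernel_mult_dilation[OF \<phi> G' star[OF z]] by (rule borel_measurable_integrable)
        show "?f' z \<in> borel_measurable lborel"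
          by measurable
        show "?s i \<in> borel_measurable lborel" for i
          using int[OF XS(1)[of i]] int[OF z] by (intro borel_measurable_integrable) auto
        show "integrable lborel (\<lambda>t. M * norm (indicator {0<..<1} t *\<^sub>R \<phi> t))"
          using \<phi> unfolding set_integrable_def by (intro integrable_mult_right integrable_norm)
        show "AE t in lborel. (\<lambda>i. ?s i t) \<longlonglongrightarrow> ?f' z t"
        proof (rule AE_I2)
          fix t :: real
          show "(\<lambda>i. ?s i t) \<longlonglongrightarrow> ?f' z t"
          proof (cases "t \<in> {0<..<1}")
            case True
            hence "((\<lambda>w. (G (of_real t * w) - G (of_real t * z)) / (w - z))
                \<longlongrightarrow> of_real t * deriv G (of_real t * z)) (at z within ball z r)"
              using dG[of t z "ball z r"] r(1) by (simp add: has_field_derivative_iff)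
            hence "(\<lambda>i. (G (of_real t * X i) - G (of_real t * z)) / (X i - z))
                \<longlonglongrightarrow> of_real t * deriv G (of_real t * z)"
              using X unfolding tendsto_at_iff_sequentially by (simp add: o_def)
            from tendsto_mult_left[OF this, of "\<phi> t"] True show ?thesis
              by (simp add: mult_ac right_diff_distrib)
          qed simp
        qed
        show "AE t in lborel. norm (?s i t) \<le> M * norm (indicator {0<..<1} t *\<^sub>R \<phi> t)" for i
        proof (rule AE_I2)
          fix t :: real
          show "norm (?s i t) \<le> M * norm (indicator {0<..<1} t *\<^sub>R \<phi> t)"
          proof (cases "t \<in> {0<..<1}")
            case True
            have "norm (?s i t)
                = norm (\<phi> t) * (norm (G (of_real t * X i) - G (of_real t * z)) / norm (X i - z))"
              using True by (simp add: norm_mult norm_divide flip: right_diff_distrib)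
            also have "\<dots> \<le> norm (\<phi> t) * M"
              using lip[of t "X i"] XS[of i] True by (intro mult_left_mono) (auto simp: divide_le_eq)
            finally show ?thesis
              using True by (simp add: mult.commute)
          qed simp
        qed
      qed
      moreover have "integral\<^sup>L lborel (?s i)
          = (integral\<^sup>L lborel (?f (X i)) - integral\<^sup>L lborel (?f z)) / (X i - z)" for i
        using int[OF XS(1)[of i]] int[OF z] by simp
      ultimately show "((\<lambda>w. (integral\<^sup>L lborel (?f w) - integral\<^sup>L lborel (?f z)) / (w - z)) \<circ> X)
          \<longlonglongrightarrow> integral\<^sup>L lborel (?f' z)"
        unfolding o_def by (simp only:)
    qed
    moreover have "at z within ball z r = at z"
      using r(1) by (intro at_within_open) auto
    ultimately show ?thesis
      unfolding has_field_derivative_iff by (simp only:)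
  qed
  show ?thesis
    unfolding set_lebesgue_integral_def holomorphic_on_def
  proof
    fix z assume "z \<in> S"
    show "(\<lambda>z. integral\<^sup>L lborel (?f z)) field_differentiable at z within S"
      by (rule field_differentiable_at_within, unfold field_differentiable_def, rule exI)
         (rule deriv[OF \<open>z \<in> S\<close>])
  qed
qed

text \<open>Integrate term by term: the factor \<open>t ^ n\<close> shifts \<open>p\<close> to
  \<open>p + n\<close>, and the quotient of the two Beta values is the stated ratio. The interchange
  rests on absolute summability of \<open>g n * z ^ n\<close> and integrability of the
  kernel.\<close>

lemma Beta_kernel_power_series:
  fixes p q z :: complex and g :: "nat \<Rightarrow> complex"
  assumes pq: "Re p > 0" "Re q > 0" and z: "norm z < 1"
    and G: "\<And>w. norm w < 1 \<Longrightarrow> (\<lambda>n. g n * w ^ n) sums G w"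
  shows "(\<lambda>n. pochhammer p n / pochhammer (p + q) n * g n * z ^ n) sums
    ((LINT t:{0<..<1}|lborel.
        of_real t powr (p - 1) * of_real (1 - t) powr (q - 1) * G (of_real t * z)) / Beta p q)"
proof -
  let ?\<phi> = "\<lambda>t::real. of_real t powr (p - 1) * of_real (1 - t) powr (q - 1) :: complex"
  let ?f = "\<lambda>n t. (g n * z ^ n) * (indicator {0<..<1} t *\<^sub>R (?\<phi> t * of_real t ^ n))"
  have shift: "indicator {0<..<1} t *\<^sub>R (?\<phi> t * of_real t ^ n)
      = indicator {0<..<1} t *\<^sub>R (of_real t powr (p + of_nat n - 1) * of_real (1 - t) powr (q - 1))"
    for t :: real and n
  proof (cases "t \<in> {0<..<1}")
    case True
    hence "of_real t powr (p + of_nat n - 1) = of_real t powr (p - 1) * (of_real t ^ n :: complex)"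
      using powr_add[of "of_real t" "p - 1" "of_nat n"] by (simp add: powr_nat algebra_simps)
    thus ?thesis
      by (simp add: mult_ac)
  qed simp
  have pn: "Re (p + of_nat n) > 0" for n
    using pq by simp
  have int: "integrable lborel (?f n)" for n
    unfolding shift using set_integrable_complex_Beta[OF pn pq(2), of n]
    by (intro integrable_mult_right) (simp add: set_integrable_def)
  \<comment> \<open>Convergence at the real point \<open>r\<close>, of larger modulus than
    \<open>z\<close>, yields absolute convergence at \<open>z\<close>.\<close>
  obtain r where r: "norm z < r" "r < 1"
    using z dense by blast
  hence "0 < r"
    using norm_ge_zero[of z] by linarith
  have "summable (\<lambda>n. g n * of_real r ^ n)"
    using G[of "of_real r"] r \<open>0 < r\<close> by (auto simp: sums_iff)
  hence norm_summable: "summable (\<lambda>n. norm (g n * z ^ n))"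
    by (rule powser_insidea) (use r \<open>0 < r\<close> in auto)
  have "(\<lambda>n. integral\<^sup>L lborel (?f n)) sums (\<integral>t. (\<Sum>n. ?f n t) \<partial>lborel)"
  proof (rule sums_integral[OF int])
    have bound: "norm (?f n t) \<le> norm (g n * z ^ n) * norm (indicator {0<..<1} t *\<^sub>R ?\<phi> t)" for n t
    proof (cases "t \<in> {0<..<1}")
      case True
      have "norm (?\<phi> t) * t ^ n \<le> norm (?\<phi> t) * 1"
        using True by (intro mult_left_mono power_le_one) auto
      hence "norm (g n * z ^ n) * (norm (?\<phi> t) * t ^ n) \<le> norm (g n * z ^ n) * norm (?\<phi> t)"
        by (intro mult_left_mono) auto
      thus ?thesis
        using True by (simp add: norm_mult norm_power)
    qed simp
    show "AE t in lborel. summable (\<lambda>n. norm (?f n t))"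
    proof (rule AE_I2)
      fix t :: real
      show "summable (\<lambda>n. norm (?f n t))"
        by (rule summable_comparison_test'[OF summable_mult2[OF norm_summable]]) (use bound in auto)
    qed
    have \<phi>: "integrable lborel (\<lambda>t. indicator {0<..<1} t *\<^sub>R ?\<phi> t)"
      using set_integrable_complex_Beta[OF pq] by (simp add: set_integrable_def)
    show "summable (\<lambda>n. \<integral>t. norm (?f n t) \<partial>lborel)"
    proof (rule summable_comparison_test'[OF summable_mult2[OF norm_summable]])
      fix n :: nat
      have "(\<integral>t. norm (?f n t) \<partial>lborel)
          \<le> (\<integral>t. norm (g n * z ^ n) * norm (indicator {0<..<1} t *\<^sub>R ?\<phi> t) \<partial>lborel)"
        by (intro integral_mono integrable_norm int integrable_mult_right \<phi> bound)
      also have "\<dots> = norm (g n * z ^ n) * (\<integral>t. norm (indicator {0<..<1} t *\<^sub>R ?\<phi> t) \<partial>lborel)"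
        by (rule integral_mult_right_zero)
      finally show "norm (\<integral>t. norm (?f n t) \<partial>lborel)
          \<le> norm (g n * z ^ n) * (\<integral>t. norm (indicator {0<..<1} t *\<^sub>R ?\<phi> t) \<partial>lborel)"
        by simp
    qed
  qed
  moreover have "integral\<^sup>L lborel (?f n)
      = pochhammer p n / pochhammer (p + q) n * g n * z ^ n * Beta p q" for n
    using complex_Beta_integral[OF pn pq(2), of n]
    unfolding shift integral_mult_right_zero set_lebesgue_integral_def Beta_add_of_nat[OF pq]
    by (simp add: mult_ac)
  moreover have "(\<Sum>n. ?f n t) = indicator {0<..<1} t *\<^sub>R (?\<phi> t * G (of_real t * z))" for t
  proof (cases "t \<in> {0<..<1}")
    case True
    hence "norm (of_real t * z) < 1"
      using z mult_strict_mono'[of t 1 "norm z" 1] by (simp add: norm_mult)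
    from sums_mult[OF G[OF this], of "?\<phi> t"]
    have "(\<lambda>n. ?f n t) sums (?\<phi> t * G (of_real t * z))"
      using True by (simp add: power_mult_distrib mult_ac)
    thus ?thesis
      using True by (simp add: sums_iff)
  qed simp
  ultimately have "(\<lambda>n. pochhammer p n / pochhammer (p + q) n * g n * z ^ n * Beta p q) sums
      (LINT t:{0<..<1}|lborel. ?\<phi> t * G (of_real t * z))"
    by (simp add: set_lebesgue_integral_def)
  moreover have "Beta p q \<noteq> 0"
    using pq not_nonpos_Int_if_Re_pos[of p] not_nonpos_Int_if_Re_pos[of q] not_nonpos_Int_if_Re_pos[of "p + q"]
    by (simp add: Beta_def Gamma_eq_zero_iff)
  ultimately show ?thesis
    using sums_divide[of _ _ "Beta p q"] by fastforce
qed

subsection \<open>Analytic continuation and the fractional integral\<close>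

text \<open>The factor \<open>z\<close> accounts for the index shift in the last term, and the
  constant terms match because every Gauss series starts with 1.\<close>

lemma hyp2F1_series_contiguous:
  assumes coeff: "\<And>n. gauss_coeff a b c (Suc n)
      = gauss_coeff a' b' c' (Suc n) + k * gauss_coeff a'' b'' c'' n"
    and z: "norm z < 1"
  shows "hyp2F1_series a b c z = hyp2F1_series a' b' c' z + k * z * hyp2F1_series a'' b'' c'' z"
proof -
  have head: "gauss_coeff a b c 0 = 1" for a b c
    by (simp add: gauss_coeff_def)
  have "(\<lambda>n. gauss_coeff a' b' c' (Suc n) * z ^ Suc n) sums (hyp2F1_series a' b' c' z - 1)"
    using hyp2F1_series_sums[OF z, of a' b' c']
    by (subst sums_Suc_iff) (simp add: head)
  from sums_add[OF this sums_mult[OF hyp2F1_series_sums[OF z, of a'' b'' c''], of "k * z"]]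
  have "(\<lambda>n. gauss_coeff a b c (Suc n) * z ^ Suc n) sums
      (hyp2F1_series a' b' c' z - 1 + k * z * hyp2F1_series a'' b'' c'' z)"
    by (simp add: coeff algebra_simps)
  hence "(\<lambda>n. gauss_coeff a b c n * z ^ n) sums
      (hyp2F1_series a' b' c' z - 1 + k * z * hyp2F1_series a'' b'' c'' z + 1)"
    by (subst (asm) sums_Suc_iff) (simp add: head)
  with hyp2F1_series_sums[OF z, of a b c] show ?thesis
    by (simp add: sums_iff)
qed

text \<open>Both terms on the right have \<open>c - b\<close> raised by 1. Apart from a common
  factor the identity is the partial fraction
  \<open>1 / (Q * N) + 1 / (c * Q) = (c + N) / (c * Q * N)\<close>.\<close>

lemma gauss_coeff_shift_c:
  assumes "Re c > 0"
  shows "gauss_coeff a b c (Suc n) = gauss_coeff a b (c + 1) (Suc n)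
           + a * b / (c * (c + 1)) * gauss_coeff (a + 1) (b + 1) (c + 2) n"
proof -
  define P where "P = pochhammer (c + 1) n"
  \<comment> \<open>This is \<open>(c + 1)_(n+1)\<close>, split at its first factor; splitting at
    the last factor gives \<open>P * (c + N)\<close>.\<close>
  define Q where "Q = (c + 1) * pochhammer (c + 2) n"
  define N where "N = (of_nat (Suc n) :: complex)"
  have nz: "c \<noteq> 0" "Q \<noteq> 0" "N \<noteq> 0"
    using assms pochhammer_nonzero_if_Re_pos[of "c + 1" 1] pochhammer_nonzero_if_Re_pos[of "c + 2" n]
    by (auto simp: Q_def N_def simp del: of_nat_Suc)
  have PQ: "Q = P * (c + N)"
    using pochhammer_rec[of "c + 1" n] pochhammer_Suc[of "c + 1" n]
    by (simp add: P_def Q_def N_def algebra_simps)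
  have "1 / (Q * N) + 1 / (c * Q) = (c + N) / (c * Q * N)"
    using nz by (simp add: field_simps)
  also have "\<dots> = 1 / (c * P * N)"
    using nz(2) unfolding PQ by simp
  finally have eq: "1 / (c * P * N) = 1 / (Q * N) + 1 / (c * Q)" ..
  define A where "A = a * pochhammer (a + 1) n * (b * pochhammer (b + 1) n) / fact n"
  have "gauss_coeff a b c (Suc n) = A * (1 / (c * P * N))"
    by (simp add: gauss_coeff_def pochhammer_rec A_def P_def N_def mult_ac)
  also have "\<dots> = A * (1 / (Q * N)) + A * (1 / (c * Q))"
    unfolding eq by (rule distrib_left)
  also have "A * (1 / (Q * N)) = gauss_coeff a b (c + 1) (Suc n)"
    by (simp add: gauss_coeff_def pochhammer_rec A_def Q_def N_def mult_ac add.commute)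
  also have "A * (1 / (c * Q))
      = a * b / (c * (c + 1)) * gauss_coeff (a + 1) (b + 1) (c + 2) n"
    by (simp add: gauss_coeff_def A_def Q_def mult_ac)
  finally show ?thesis .
qed

text \<open>Both terms on the right have \<open>b\<close> raised by 1. Apart from a common factor
  the identity reads \<open>b / (n + 1) = (b + n + 1) / (n + 1) - 1\<close>.\<close>

lemma gauss_coeff_shift_b:
  "gauss_coeff a b c (Suc n) = gauss_coeff a (b + 1) c (Suc n)
     + - (a / c) * gauss_coeff (a + 1) (b + 1) (c + 1) n"
proof -
  define A where "A = a * pochhammer (a + 1) n * pochhammer (b + 1) n / (c * pochhammer (c + 1) n * fact n)"
  have 1: "gauss_coeff a b c (Suc n) = A * (b / of_nat (Suc n))"
    by (simp add: gauss_coeff_def pochhammer_rec A_def mult_ac)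
  have 2: "gauss_coeff a (b + 1) c (Suc n) = A * ((b + of_nat (Suc n)) / of_nat (Suc n))"
    by (simp add: gauss_coeff_def pochhammer_rec[of a] pochhammer_rec[of c] pochhammer_Suc[of "b + 1"]
        A_def mult_ac add.assoc)
  have 3: "a / c * gauss_coeff (a + 1) (b + 1) (c + 1) n = A"
    by (simp add: gauss_coeff_def A_def mult_ac)
  have "b / of_nat (Suc n) = (b + of_nat (Suc n)) / of_nat (Suc n) - 1"
    by (simp add: add_divide_distrib del: of_nat_Suc)
  thus ?thesis
    using 1 2 3 by (simp add: right_diff_distrib del: of_nat_Suc)
qed

section \<open>Existence of the analytic continuation\<close>

text \<open>This is the property under \<open>SOME\<close> in \<open>hyp2F1\<close>, which can be
  used only once a function with it has been exhibited.\<close>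

definition is_gauss_continuation :: "complex \<Rightarrow> complex \<Rightarrow> complex \<Rightarrow> (complex \<Rightarrow> complex) \<Rightarrow> bool" where
  "is_gauss_continuation a b c f \<longleftrightarrow>
     f holomorphic_on cut_plane \<and> (\<forall>z. norm z < 1 \<longrightarrow> f z = hyp2F1_series a b c z)"

lemma gauss_continuation_contiguous:
  assumes "\<And>n. gauss_coeff a b c (Suc n)
      = gauss_coeff a' b' c' (Suc n) + k * gauss_coeff a'' b'' c'' n"
    and "\<exists>f. is_gauss_continuation a' b' c' f" "\<exists>f. is_gauss_continuation a'' b'' c'' f"
  shows "\<exists>f. is_gauss_continuation a b c f"
proof -
  obtain f g where fg: "is_gauss_continuation a' b' c' f" "is_gauss_continuation a'' b'' c'' g"
    using assms(2,3) by blast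
  have "(\<lambda>z. f z + k * z * g z) holomorphic_on cut_plane"
    using fg by (intro holomorphic_intros) (auto simp: is_gauss_continuation_def)
  hence "is_gauss_continuation a b c (\<lambda>z. f z + k * z * g z)"
    using fg hyp2F1_series_contiguous[OF assms(1)] by (simp add: is_gauss_continuation_def)
  thus ?thesis
    by (rule exI[of _ "\<lambda>z. f z + k * z * g z"])
qed

text \<open>Euler's integral is the Beta transform with \<open>p = b\<close> and
  \<open>q = c - b\<close> of \<open>(1 - z) powr (- a)\<close>: the multiplier
  \<open>(b)_n / (c)_n\<close> turns the binomial coefficient \<open>(a)_n / n!\<close> into the
  Gauss coefficient.\<close>

lemma gauss_continuation_Euler:
  assumes "Re b > 0" "Re (c - b) > 0"
  shows "\<exists>f. is_gauss_continuation a b c f"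
proof
  let ?H = "\<lambda>z. LINT t:{0<..<1}|lborel.
    of_real t powr (b - 1) * of_real (1 - t) powr (c - b - 1) * (1 - of_real t * z) powr (- a)"
  have "?H holomorphic_on cut_plane"
    by (rule holomorphic_kernel_dilation_integral[OF set_integrable_complex_Beta[OF assms] open_cut_plane
          of_real_mult_in_cut_plane holomorphic_one_minus_powr])
  moreover have "Beta b (c - b) \<noteq> 0"
    using assms not_nonpos_Int_if_Re_pos[of b] not_nonpos_Int_if_Re_pos[of c]
      not_nonpos_Int_if_Re_pos[of "c - b"]
    by (simp add: Beta_def Gamma_eq_zero_iff)
  ultimately have "(\<lambda>z. ?H z / Beta b (c - b)) holomorphic_on cut_plane"
    by (intro holomorphic_intros) auto
  moreover have "?H z / Beta b (c - b) = hyp2F1_series a b c z" if z: "norm z < 1" for z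
  proof -
    have "(\<lambda>n. pochhammer b n / pochhammer (b + (c - b)) n * binom_coeff a n * z ^ n)
        sums (?H z / Beta b (c - b))"
      by (rule Beta_kernel_power_series[OF assms z binom_series_sums])
    moreover have "pochhammer b n / pochhammer (b + (c - b)) n * binom_coeff a n = gauss_coeff a b c n" for n
      by (simp add: gauss_coeff_def binom_coeff_def)
    ultimately have "(\<lambda>n. gauss_coeff a b c n * z ^ n) sums (?H z / Beta b (c - b))"
      by (simp only:)
    thus ?thesis
      using hyp2F1_series_sums[OF z] by (rule sums_unique2)
  qed
  ultimately show "is_gauss_continuation a b c (\<lambda>z. ?H z / Beta b (c - b))"
    by (simp add: is_gauss_continuation_def)
qed

text \<open>
  Euler's integral covers \<open>0 < Re b < Re c\<close>. Both contiguous relations express the series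
  through series with larger \<open>Re (c - b)\<close>, resp. larger \<open>Re b\<close>, and divide only by \<open>c\<close> and
  \<open>c + 1\<close>, so no exceptional parameters arise on the way down.
\<close>

lemma gauss_continuation_exists:
  assumes "Re c > 0"
  shows "\<exists>f. is_gauss_continuation a b c f"
proof -
  \<comment> \<open>Here \<open>n\<close> bounds how far \<open>Re (c - b)\<close> is from positive;
    each use of the relation in \<open>c\<close> gains 1 and keeps \<open>Re b\<close> and
    \<open>Re c\<close> positive.\<close>
  have b_pos: "\<exists>f. is_gauss_continuation a b c f"
    if "Re b > 0" "Re c > 0" "Re (c - b) > - real n" for a b c n
    using that
  proof (induction n arbitrary: a b c)
    case 0
    thus ?case
      by (intro gauss_continuation_Euler) auto
  next
    case (Suc n)
    show ?case
      by (rule gauss_continuation_contiguous[OF gauss_coeff_shift_c]) (use Suc in auto)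
  qed
  have "\<exists>f. is_gauss_continuation a b c f" if "Re b > - real n" "Re c > 0" for a b c n
    using that
  proof (induction n arbitrary: a b c)
    case 0
    \<comment> \<open>Once \<open>Re b\<close> is positive, the previous claim applies with enough
      shifts in \<open>c\<close>.\<close>
    moreover obtain n where "Re (b - c) < real n"
      using reals_Archimedean2 by blast
    ultimately show ?case
      by (intro b_pos[of _ _ n]) auto
  next
    case (Suc n)
    show ?case
      by (rule gauss_continuation_contiguous[OF gauss_coeff_shift_b]) (use Suc in auto)
  qed
  moreover obtain n where "- Re b < real n"
    using reals_Archimedean2 by blast
  ultimately show ?thesis
    using assms by (metis minus_less_iff)
qed

lemma hyp2F1_is_gauss_continuation:
  assumes "Re c > 0"
  shows "is_gauss_continuation a b c (hyp2F1 a b c)"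
  using someI_ex[OF gauss_continuation_exists[OF assms, of a b]]
  by (simp add: hyp2F1_def is_gauss_continuation_def cut_plane_def)

section \<open>The fractional integral\<close>

text \<open>Stated for complex \<open>z\<close> so that the identity theorem applies: in the unit
  disc both sides have the same Taylor coefficients by
  \<open>pochhammer_quotient_convolution\<close>.\<close>

lemma hyp2F1_Beta_integral:
  fixes a b c \<mu> z :: complex
  assumes c: "Re c > 0" and \<mu>: "Re \<mu> > 0" and z: "z \<in> cut_plane"
  defines "G \<equiv> \<lambda>w. (1 - w) powr (b - c - \<mu>) * hyp2F1 a b c w"
  shows "set_integrable lborel {0<..<1}
           (\<lambda>t. of_real t powr (c - 1) * of_real (1 - t) powr (\<mu> - 1) * G (of_real t * z))"
    and "(LINT t:{0<..<1}|lborel.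
             of_real t powr (c - 1) * of_real (1 - t) powr (\<mu> - 1) * G (of_real t * z))
         = Beta c \<mu> * ((1 - z) powr (b - c) * hyp2F1 (a + \<mu>) b (c + \<mu>) z)"
proof -
  let ?H = "\<lambda>z. LINT t:{0<..<1}|lborel.
    of_real t powr (c - 1) * of_real (1 - t) powr (\<mu> - 1) * G (of_real t * z)"
  have c\<mu>: "Re (c + \<mu>) > 0"
    using c \<mu> by simp
  have F: "hyp2F1 a b c holomorphic_on cut_plane" "hyp2F1 (a + \<mu>) b (c + \<mu>) holomorphic_on cut_plane"
    and series: "\<And>w. norm w < 1 \<Longrightarrow> hyp2F1 a b c w = hyp2F1_series a b c w"
      "\<And>w. norm w < 1 \<Longrightarrow> hyp2F1 (a + \<mu>) b (c + \<mu>) w = hyp2F1_series (a + \<mu>) b (c + \<mu>) w"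
    using hyp2F1_is_gauss_continuation[OF c, of a b]
      hyp2F1_is_gauss_continuation[OF c\<mu>, of "a + \<mu>" b]
    by (auto simp: is_gauss_continuation_def)
  have G: "G holomorphic_on cut_plane"
    unfolding G_def by (intro holomorphic_on_mult holomorphic_one_minus_powr F)
  show "set_integrable lborel {0<..<1}
      (\<lambda>t. of_real t powr (c - 1) * of_real (1 - t) powr (\<mu> - 1) * G (of_real t * z))"
    unfolding set_integrable_def
    by (rule integrable_kernel_mult_dilation[OF set_integrable_complex_Beta[OF c \<mu>]
          holomorphic_on_imp_continuous_on[OF G] of_real_mult_in_cut_plane[OF z]])
  have B: "Beta c \<mu> \<noteq> 0"
    using c \<mu> c\<mu> by (simp add: Beta_def Gamma_eq_zero_iff not_nonpos_Int_if_Re_pos)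
  show "?H z = Beta c \<mu> * ((1 - z) powr (b - c) * hyp2F1 (a + \<mu>) b (c + \<mu>) z)"
  proof (rule cut_plane_identity_theorem[OF _ _ _ z])
    show "?H holomorphic_on cut_plane"
      by (rule holomorphic_kernel_dilation_integral[OF set_integrable_complex_Beta[OF c \<mu>] open_cut_plane
            of_real_mult_in_cut_plane G])
    show "(\<lambda>z. Beta c \<mu> * ((1 - z) powr (b - c) * hyp2F1 (a + \<mu>) b (c + \<mu>) z)) holomorphic_on cut_plane"
      by (intro holomorphic_on_mult holomorphic_on_const holomorphic_one_minus_powr F)
    fix w :: complex assume w: "norm w < 1"
    \<comment> \<open>Taylor coefficients of \<open>G\<close>, whose exponent
      \<open>b - c - \<mu>\<close> is \<open>- s\<close> for
      \<open>s = c + \<mu> - b\<close>.\<close>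
    let ?g = "\<lambda>n. \<Sum>j\<le>n. binom_coeff (c + \<mu> - b) j * gauss_coeff a b c (n - j)"
    have "(\<lambda>n. ?g n * w ^ n) sums G w" if "norm w < 1" for w
      using binom_gauss_series_sums[OF that, of "c + \<mu> - b" a b c]
      by (simp add: G_def series(1)[OF that] algebra_simps)
    from Beta_kernel_power_series[OF c \<mu> w this]
    have "(\<lambda>n. (\<Sum>j\<le>n. binom_coeff (c - b) j * gauss_coeff (a + \<mu>) b (c + \<mu>) (n - j)) * w ^ n)
        sums (?H w / Beta c \<mu>)"
      unfolding pochhammer_quotient_convolution[OF c \<mu>] .
    moreover have "(\<lambda>n. (\<Sum>j\<le>n. binom_coeff (c - b) j * gauss_coeff (a + \<mu>) b (c + \<mu>) (n - j)) * w ^ n)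
        sums ((1 - w) powr (b - c) * hyp2F1 (a + \<mu>) b (c + \<mu>) w)"
      using binom_gauss_series_sums[OF w, of "c - b" "a + \<mu>" b "c + \<mu>"] by (simp add: series(2)[OF w])
    ultimately have "?H w / Beta c \<mu> = (1 - w) powr (b - c) * hyp2F1 (a + \<mu>) b (c + \<mu>) w"
      by (rule sums_unique2)
    thus "?H w = Beta c \<mu> * ((1 - w) powr (b - c) * hyp2F1 (a + \<mu>) b (c + \<mu>) w)"
      using B by (simp add: field_simps)
  qed
qed

theorem mainTheorem2:
  fixes a b c \<mu> :: complex and x :: real
  assumes "Re c > 0" and "Re \<mu> > 0"
    and "x \<in> {..<0} \<union> {0<..<1}"
  defines "I \<equiv> {y :: real. 0 < y / x \<and> y / x < 1}"
    and "f \<equiv> (\<lambda>y :: real.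
           complex_of_real \<bar>y\<bar> powr (c - 1) * complex_of_real (1 - y) powr (b - c - \<mu>)
           * hyp2F1 a b c (complex_of_real y)
           * (complex_of_real \<bar>x - y\<bar> powr (\<mu> - 1) / Gamma \<mu>))"
  shows "set_integrable lborel I f \<and>
         (LINT y:I|lborel. f y) =
           Gamma c / Gamma (c + \<mu>)
           * complex_of_real \<bar>x\<bar> powr (c + \<mu> - 1) * complex_of_real (1 - x) powr (b - c)
           * hyp2F1 (a + \<mu>) b (c + \<mu>) (complex_of_real x)"
proof -
  have x: "x \<noteq> 0" "complex_of_real x \<in> cut_plane"
    using assms(3) by (auto simp: cut_plane_iff)
  let ?X = "complex_of_real \<bar>x\<bar>"
  let ?h = "\<lambda>t::real. complex_of_real t powr (c - 1) * complex_of_real (1 - t) powr (\<mu> - 1)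
    * ((1 - complex_of_real t * complex_of_real x) powr (b - c - \<mu>)
       * hyp2F1 a b c (complex_of_real t * complex_of_real x))"
  \<comment> \<open>Collects \<open>1 / Gamma \<mu>\<close> and the powers of
    \<open>\<bar>x\<bar>\<close> that come out of \<open>\<bar>y\<bar>\<close> and
    \<open>\<bar>x - y\<bar>\<close> when \<open>y = x * t\<close>.\<close>
  define K where "K = ?X powr (c - 1) * ?X powr (\<mu> - 1) / Gamma \<mu>"
  \<comment> \<open>Either sign of \<open>x\<close> is covered at once: \<open>y / x = t\<close>,
    \<open>\<bar>y\<bar> = \<bar>x\<bar> * t\<close> and
    \<open>\<bar>x - y\<bar> = \<bar>x\<bar> * (1 - t)\<close> for \<open>t\<close> in the unit
    interval.\<close>
  have dilate: "indicator I (x * t) *\<^sub>R f (x * t) = K * (indicator {0<..<1} t *\<^sub>R ?h t)" for t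
  proof (cases "t \<in> {0<..<1}")
    case True
    have "\<bar>x * t\<bar> = \<bar>x\<bar> * t" "\<bar>x - x * t\<bar> = \<bar>x\<bar> * (1 - t)"
      using True abs_mult[of x "1 - t"] by (simp_all add: abs_mult right_diff_distrib)
    moreover have "(?X * of_real t) powr (c - 1) = ?X powr (c - 1) * of_real t powr (c - 1)"
      "(?X * of_real (1 - t)) powr (\<mu> - 1) = ?X powr (\<mu> - 1) * of_real (1 - t) powr (\<mu> - 1)"
      using True by (intro powr_times_real; simp)+
    ultimately show ?thesis
      using True x(1) by (simp add: I_def f_def K_def mult_ac)
  next
    case False
    thus ?thesis
      using x(1) by (auto simp: I_def)
  qed
  note h = hyp2F1_Beta_integral[OF assms(1,2) x(2), where a = a and b = b]
  have "integrable lborel (\<lambda>t. indicator I (x * t) *\<^sub>R f (x * t))"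
    using h(1) unfolding dilate set_integrable_def by (rule integrable_mult_right)
  hence integrable: "set_integrable lborel I f"
    using lborel_integrable_real_affine_iff[OF x(1), of "\<lambda>y. indicator I y *\<^sub>R f y" 0]
    by (simp add: set_integrable_def)
  \<comment> \<open>The leading \<open>?X\<close> is the Jacobian; it raises the total exponent
    \<open>(c - 1) + (\<mu> - 1)\<close> to \<open>c + \<mu> - 1\<close>, while
    \<open>Gamma \<mu>\<close> cancels against the Beta value.\<close>
  have X: "?X * K * Beta c \<mu> = Gamma c / Gamma (c + \<mu>) * ?X powr (c + \<mu> - 1)"
  proof -
    have "?X powr (c + \<mu> - 1) = ?X * ?X powr (c - 1) * ?X powr (\<mu> - 1)"
      using x(1) powr_add[of ?X 1 "c - 1"] powr_add[of ?X c "\<mu> - 1"] by (simp add: add_diff_eq)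
    moreover have "Gamma \<mu> \<noteq> 0"
      using assms(2) by (simp add: Gamma_eq_zero_iff not_nonpos_Int_if_Re_pos)
    ultimately show ?thesis
      using x(1) by (simp add: K_def Beta_def)
  qed
  have "(LINT y:I|lborel. f y) = \<bar>x\<bar> *\<^sub>R (\<integral>t. indicator I (x * t) *\<^sub>R f (x * t) \<partial>lborel)"
    using lborel_integral_real_affine[OF x(1), of "\<lambda>y. indicator I y *\<^sub>R f y" 0]
    by (simp add: set_lebesgue_integral_def)
  also have "(\<integral>t. indicator I (x * t) *\<^sub>R f (x * t) \<partial>lborel)
      = K * (Beta c \<mu> * ((1 - of_real x) powr (b - c) * hyp2F1 (a + \<mu>) b (c + \<mu>) (of_real x)))"
    using h(2) unfolding dilate set_lebesgue_integral_def integral_mult_right_zero by simp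
  also have "\<bar>x\<bar> *\<^sub>R \<dots> = (?X * K * Beta c \<mu>)
      * ((1 - of_real x) powr (b - c) * hyp2F1 (a + \<mu>) b (c + \<mu>) (of_real x))"
    by (simp add: scaleR_conv_of_real)
  finally show ?thesis
    unfolding X using integrable by simp
qed

end
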